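(* Let $m,n\ge 1$, $A\in\mathbb{R}^{m\times n^2}$, $f\in\mathbb{R}^m$, $\mu>0$, and suppose $\mathcal{N}(A)\cap\mathcal{N}(D)=\{0\}$, where $\mathcal N(\cdot)$ denotes the null space. Then for any fixed $\beta>0$ and any $\tau$ with $0<\tau<2/\lambda_{\max}(A^\top A)$, where $\lambda_{\max}(A^\top A)$ denotes the spectral radius of $A^\top A$, the sequence $\{(w^k,u^k)\}$ generated by the FTVCS iteration from any starting point $(w^0,u^0)\in\mathbb{R}^{2n^2}\times\mathbb{R}^{n^2}$ converges to a solution $(w^*,u^* )$ of $$\min_{u,w}\ \sum_{i=1}^{n^2}\Big(\|\mathbf{w}_i\|+\frac{\beta}{2}\|\mathbf{w}_i-D_iu\|^2\Big)+\frac{\mu}{2}\|Au-f\|^2 .$$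
   Context: All norms $\|\cdot\|$ are Euclidean. An $n\times n$ image is identified with a vector $u\in\mathbb{R}^{n^2}$. $D^{(1)},D^{(2)}\in\mathbb{R}^{n^2\times n^2}$ are the first-order finite difference matrices in the horizontal and vertical directions, with periodic boundary conditions; $D=\begin{pmatrix}D^{(1)}\\ D^{(2)}\end{pmatrix}\in\mathbb{R}^{2n^2\times n^2}$; and $D_i\in\mathbb{R}^{2\times n^2}$ is formed by stacking the $i$th row of $D^{(1)}$ on that of $D^{(2)}$. A vector $w\in\mathbb{R}^{2n^2}$ is a reordering of vectors $\mathbf{w}_i\in\mathbb{R}^2$, $i=1,\dots,n^2$, where $\mathbf{w}_i$ has entries $w_i$ and $w_{i+n^2}$ (so $w=Du$ iff $\mathbf{w}_i=D_iu$ for all $i$). FTVCS iteration (parameters $\mu,\beta,\tau>0$): given $u^k$, (1) for $i=1,\dots,n^2$ set $\mathbf{w}_i^{k+1}=\max\{\|D_iu^k\|-1/\beta,\,0\}\,\dfrac{D_iu^k}{\|D_iu^k\|}$, with the convention $0\cdot(0/0)=0$; (2) let $u^{k+1}$ be the solution of $\big(D^\top D+\frac{\mu}{\beta\tau}I\big)u^{k+1}=D^\top w^{k+1}+\frac{\mu}{\beta\tau}(u^k-\tau g_k)$, where $g_k=A^\top(Au^k-f)$. *)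

theory Defs
  imports "HOL-Analysis.Analysis"
begin

text \<open>
  The \<open>n \<times> n\<close> pixel grid is the type \<open>'n \<times> 'n\<close> of (row, column) pairs, where \<open>'n\<close> is a finite linear
  order with \<open>n = CARD('n)\<close> elements; images are vectors in \<open>real ^ ('n \<times> 'n)\<close>.  Stacked vectors of
  length \<open>2 n\<^sup>2\<close> are indexed by the sum type, \<open>Inl i\<close> and \<open>Inr i\<close> standing for positions \<open>i\<close> and
  \<open>i + n\<^sup>2\<close>.
\<close>

definition cyc_succ :: "'n::{finite,linorder} \<Rightarrow> 'n" where
  "cyc_succ i = (if i = Max UNIV then Min UNIV else Min {j. i < j})"

text \<open>
  Periodic forward differences.  The matrix entries are differences of two Kronecker deltas, so for
  \<open>n = 1\<close>, where a pixel is its own neighbour, both matrices are zero.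
\<close>

definition Dh :: "real ^ ('n \<times> 'n) ^ ('n::{finite,linorder} \<times> 'n)" where
  "Dh = (\<chi> p q. of_bool (q = (fst p, cyc_succ (snd p))) - of_bool (q = p))"

definition Dv :: "real ^ ('n \<times> 'n) ^ ('n::{finite,linorder} \<times> 'n)" where
  "Dv = (\<chi> p q. of_bool (q = (cyc_succ (fst p), snd p)) - of_bool (q = p))"

definition Dfull :: "real ^ ('n \<times> 'n) ^ (('n::{finite,linorder} \<times> 'n) + ('n \<times> 'n))" where
  "Dfull = (\<chi> k. case k of Inl i \<Rightarrow> row i Dh | Inr i \<Rightarrow> row i Dv)"

definition Dpix :: "'n::{finite,linorder} \<times> 'n \<Rightarrow> real ^ ('n \<times> 'n) ^ 2" where
  "Dpix i = vector [row i Dh, row i Dv]"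

definition block :: "real ^ ('p::finite + 'p) \<Rightarrow> 'p \<Rightarrow> real ^ 2" where
  "block w i = vector [w $ Inl i, w $ Inr i]"

definition null_space :: "real ^ 'n ^ 'm \<Rightarrow> (real ^ 'n) set" where
  "null_space M = {x. M *v x = 0}"

definition spectral_radius :: "real ^ 'n ^ 'n \<Rightarrow> real" where
  "spectral_radius M =
     Sup {cmod z | z. \<exists>v. v \<noteq> 0 \<and> map_matrix complex_of_real M *v v = z *s v}"

text \<open>The convention \<open>0 \<cdot> (0/0) = 0\<close> holds because \<open>0 /\<^sub>R 0 = 0\<close> in HOL.\<close>

definition shrink :: "real \<Rightarrow> real ^ 2 \<Rightarrow> real ^ 2" where
  "shrink \<beta> v = max (norm v - 1 / \<beta>) 0 *\<^sub>R (v /\<^sub>R norm v)"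

text \<open>
  One iteration from \<open>u\<close> to \<open>(w', u')\<close>, as a relation; it determines \<open>(w', u')\<close> uniquely
  (see \<open>ftvcs_step_ex1\<close> below).
\<close>

definition ftvcs_step ::
  "real ^ ('n \<times> 'n) ^ 'm \<Rightarrow> real ^ 'm \<Rightarrow> real \<Rightarrow> real \<Rightarrow> real \<Rightarrow>
   real ^ ('n::{finite,linorder} \<times> 'n) \<Rightarrow>
   real ^ (('n \<times> 'n) + ('n \<times> 'n)) \<Rightarrow> real ^ ('n \<times> 'n) \<Rightarrow> bool" where
  "ftvcs_step A f \<mu> \<beta> \<tau> u w' u' \<longleftrightarrow>
     (\<forall>i. block w' i = shrink \<beta> (Dpix i *v u)) \<and>
     (transpose Dfull ** Dfull + (\<mu> / (\<beta> * \<tau>)) *\<^sub>R mat 1) *v u' =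
       transpose Dfull *v w' +
       (\<mu> / (\<beta> * \<tau>)) *\<^sub>R (u - \<tau> *\<^sub>R (transpose A *v (A *v u - f)))"

definition ftvcs_objective ::
  "real ^ ('n \<times> 'n) ^ 'm \<Rightarrow> real ^ 'm \<Rightarrow> real \<Rightarrow> real \<Rightarrow>
   real ^ (('n \<times> 'n) + ('n \<times> 'n)) \<Rightarrow> real ^ ('n::{finite,linorder} \<times> 'n) \<Rightarrow> real" where
  "ftvcs_objective A f \<mu> \<beta> w u =
     (\<Sum>i\<in>UNIV. norm (block w i) + \<beta> / 2 * (norm (block w i - Dpix i *v u))\<^sup>2) +
     \<mu> / 2 * (norm (A *v u - f))\<^sup>2"

lemma block_eq_iff: "w = w' \<longleftrightarrow> (\<forall>i. block w i = block w' i)"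
proof
  assume h: "\<forall>i. block w i = block w' i"
  have "w $ k = w' $ k" for k
  proof (cases k)
    case (Inl i)
    have "block w i $ 1 = block w' i $ 1" using h by simp
    then show ?thesis by (simp add: block_def Inl)
  next
    case (Inr i)
    have "block w i $ 2 = block w' i $ 2" using h by simp
    then show ?thesis by (simp add: block_def Inr)
  qed
  then show "w = w'" by (simp add: vec_eq_iff)
qed simp

lemma block_Dfull: "block (Dfull *v u) i = Dpix i *v u"
  by (simp add: block_def Dpix_def Dfull_def vec_eq_iff forall_2 matrix_vector_mult_def)

lemma ftvcs_step_ex1:
  fixes A :: "real ^ ('n::{finite,linorder} \<times> 'n) ^ 'm"
  assumes "\<mu> > 0" "\<beta> > 0" "\<tau> > 0"
  shows "\<exists>!(w', u'). ftvcs_step A f \<mu> \<beta> \<tau> u w' u'"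
proof -
  define c where "c = \<mu> / (\<beta> * \<tau>)"
  define M :: "real ^ ('n \<times> 'n) ^ ('n \<times> 'n)" where "M = transpose Dfull ** Dfull + c *\<^sub>R mat 1"
  have c: "c > 0" using assms by (simp add: c_def)
  have M0: "x = 0" if "M *v x = 0" for x
  proof -
    have "0 = x \<bullet> (M *v x)" using that by simp
    also have "\<dots> = (Dfull *v x) \<bullet> (Dfull *v x) + c * (x \<bullet> x)"
      by (simp add: M_def matrix_vector_mult_add_rdistrib inner_add_right
          matrix_vector_mul_assoc[symmetric] dot_lmul_matrix[symmetric]
          scaleR_matrix_vector_assoc[symmetric] inner_commute)
    finally have "c * (x \<bullet> x) \<le> 0" using inner_ge_zero[of "Dfull *v x"] by linarith
    then show ?thesis using c by (metis inner_eq_zero_iff inner_ge_zero mult_le_0_iff not_less order_antisym)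
  qed
  then have inj: "inj ((*v) M)"
    by (metis (no_types, lifting) eq_iff_diff_eq_0 injI matrix_vector_mult_diff_distrib)
  then have "surj ((*v) M)"
    using linear_injective_imp_surjective matrix_vector_mul_linear by blast
  with inj have ex1: "\<exists>!u'. M *v u' = b" for b by (metis injD surjD)
  define w0 :: "real ^ (('n \<times> 'n) + ('n \<times> 'n))" where
    "w0 = (\<chi> k. case k of Inl i \<Rightarrow> shrink \<beta> (Dpix i *v u) $ 1 | Inr i \<Rightarrow> shrink \<beta> (Dpix i *v u) $ 2)"
  have "block w0 i = shrink \<beta> (Dpix i *v u)" for i
    by (simp add: block_def w0_def vec_eq_iff forall_2)
  then have w: "(\<forall>i. block w' i = shrink \<beta> (Dpix i *v u)) \<longleftrightarrow> w' = w0" for w'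
    using block_eq_iff[of w' w0] by simp
  have "ftvcs_step A f \<mu> \<beta> \<tau> u w' u' \<longleftrightarrow> w' = w0 \<and>
      M *v u' = transpose Dfull *v w0 + c *\<^sub>R (u - \<tau> *\<^sub>R (transpose A *v (A *v u - f)))" for w' u'
    unfolding ftvcs_step_def w M_def c_def by auto
  then show ?thesis
    using ex1[of "transpose Dfull *v w0 + c *\<^sub>R (u - \<tau> *\<^sub>R (transpose A *v (A *v u - f)))"]
    by auto
qed

end

theory Submission imports Defs begin

text \<open>
  One FTVCS step is an averaged operator in the energy norm
  \<open>V e = (norm (D e))\<^sup>2 + \<kappa> (norm e)\<^sup>2\<close> with \<open>\<kappa> = \<mu> / (\<beta> \<tau>)\<close>, its fixed points are exactly the
  minimizers, and the iterates of such an operator converge in finite dimension as soon as it has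
  a fixed point.

  Averagedness combines three effects.  Shrinkage is the proximal map of the Euclidean norm, hence
  firmly nonexpansive.  A gradient step with \<open>\<tau> < 2 / \<rho>\<close>, where \<open>\<rho>\<close> is the spectral radius of
  \<open>A\<^sup>T A\<close>, is itself averaged, because
  \<open>norm (A x)\<^sup>2 \<le> \<rho> * norm x\<^sup>2\<close> (lemma \<open>norm_matrix_vector_sq_le_spectral_radius\<close>).  The linear
  solve is an orthogonal projection onto the range of \<open>x \<mapsto> (D x, sqrt \<kappa> * x)\<close>, with \<open>V\<close> as the
  squared norm of the image.  Testing the difference of two steps against the
  difference of their outputs yields all of this at once:
  \<open>V (u' - v') + c * norm ((u - v) - (u' - v'))\<^sup>2 \<le> V (u - v)\<close> with \<open>c = \<kappa> (1 - \<tau> \<rho> / 2) > 0\<close>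
  (lemma \<open>ftvcs_step_averaged\<close>).

  A minimizer exists because the null space hypothesis makes the objective coercive
  (\<open>ftvcs_minimizer_exists\<close>), and the optimality conditions, which suffice by convexity, are the
  fixed point equations.  Taking a fixed point for \<open>v\<close>, the iterates are bounded and
  \<open>u (Suc k) - u k\<close> tends to \<open>0\<close>.  A cluster point is therefore a fixed point as well; the energy
  distance to it decreases and tends to \<open>0\<close> along a subsequence, hence along the whole sequence.
\<close>

section \<open>Shrinkage as a proximal map\<close>

lemma inner_eq_sum_block: "w \<bullet> w' = (\<Sum>i\<in>UNIV. block w i \<bullet> block w' i)"
proof -
  have "w \<bullet> w' = (\<Sum>k\<in>UNIV <+> UNIV. w $ k * w' $ k)"
    by (simp add: inner_vec_def)
  also have "\<dots> = (\<Sum>i\<in>UNIV. w $ Inl i * w' $ Inl i) + (\<Sum>i\<in>UNIV. w $ Inr i * w' $ Inr i)"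
    by (subst sum.Plus) simp_all
  finally show ?thesis
    by (simp add: inner_vec_def block_def sum_2 sum.distrib)
qed

lemma norm_sq_eq_sum_block: "(norm w)\<^sup>2 = (\<Sum>i\<in>UNIV. (norm (block w i))\<^sup>2)"
  by (simp add: power2_norm_eq_inner inner_eq_sum_block)

lemma block_diff: "block (w - w') i = block w i - block w' i"
  by (simp add: block_def vec_eq_iff forall_2)

lemma linear_block: "linear (\<lambda>w. block w i)"
  by (rule linearI) (simp_all add: block_def vec_eq_iff forall_2)

lemma norm_le_sum_norm_block: "norm w \<le> (\<Sum>i\<in>UNIV. norm (block w i))"
proof -
  have "norm w = L2_set (\<lambda>i. norm (block w i)) UNIV"
    by (simp add: L2_set_def norm_sq_eq_sum_block[symmetric])
  also have "\<dots> \<le> (\<Sum>i\<in>UNIV. norm (block w i))"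
    by (intro L2_set_le_sum) simp
  finally show ?thesis .
qed

text \<open>
  Shrinkage solves the optimality condition of its proximal problem
  \<open>min\<^sub>x norm x + \<beta>/2 * norm (x - v)\<^sup>2\<close>: the vector \<open>\<beta> (v - shrink \<beta> v)\<close> is a subgradient of the norm
  at \<open>shrink \<beta> v\<close>, since it lies in the unit ball and is aligned with \<open>shrink \<beta> v\<close>.
\<close>

lemma shrink_subgradient:
  assumes "\<beta> > 0"
  shows "norm (shrink \<beta> v) + \<beta> * ((v - shrink \<beta> v) \<bullet> (x - shrink \<beta> v)) \<le> norm x"
proof -
  define s where "s = shrink \<beta> v"
  define p where "p = \<beta> *\<^sub>R (v - s)"
  have "norm p \<le> 1 \<and> p \<bullet> s = norm s"
  proof (cases "norm v \<le> 1 / \<beta>")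
    case True
    then have "s = 0" by (simp add: s_def shrink_def)
    then show ?thesis using True assms by (simp add: p_def field_simps)
  next
    case False
    then have v: "norm v > 1 / \<beta>" by simp
    moreover have "1 / \<beta> > 0" using assms by simp
    ultimately have nv: "norm v > 0" by linarith
    define c where "c = 1 - 1 / (\<beta> * norm v)"
    have c: "c \<ge> 0" using v nv assms by (simp add: c_def field_simps)
    have "(norm v - 1 / \<beta>) / norm v = c" using nv by (simp add: c_def field_simps)
    then have s: "s = c *\<^sub>R v"
      using v by (simp add: s_def shrink_def max_def divide_inverse)
    have "p = (\<beta> * (1 - c)) *\<^sub>R v" by (simp add: p_def s algebra_simps)
    also have "\<beta> * (1 - c) = 1 / norm v" using assms by (simp add: c_def)
    finally have p: "p = (1 / norm v) *\<^sub>R v" .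
    show ?thesis using nv c by (simp add: p s dot_square_norm power2_eq_square)
  qed
  then have p: "norm p \<le> 1" "p \<bullet> s = norm s" by auto
  have "p \<bullet> x \<le> norm p * norm x" by (rule norm_cauchy_schwarz)
  also have "\<dots> \<le> norm x" using p(1) by (simp add: mult_left_le_one_le)
  finally have "norm s + p \<bullet> (x - s) \<le> norm x" using p(2) by (simp add: inner_diff_right)
  then show ?thesis by (simp add: p_def s_def)
qed

text \<open>
  Monotonicity of the subdifferential: add the subgradient inequality at each of the two points,
  tested against the other one.
\<close>

lemma shrink_firmly_nonexpansive:
  assumes "\<beta> > 0"
  shows "(norm (shrink \<beta> a - shrink \<beta> b))\<^sup>2 \<le> (shrink \<beta> a - shrink \<beta> b) \<bullet> (a - b)"
proof -
  have "\<beta> * ((a - shrink \<beta> a) \<bullet> (shrink \<beta> b - shrink \<beta> a)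
          + (b - shrink \<beta> b) \<bullet> (shrink \<beta> a - shrink \<beta> b)) \<le> 0"
    using shrink_subgradient[OF assms, of a "shrink \<beta> b"]
      shrink_subgradient[OF assms, of b "shrink \<beta> a"] by (simp add: distrib_left)
  then have "(a - shrink \<beta> a) \<bullet> (shrink \<beta> b - shrink \<beta> a)
          + (b - shrink \<beta> b) \<bullet> (shrink \<beta> a - shrink \<beta> b) \<le> 0"
    using assms by (simp add: mult_le_0_iff)
  then show ?thesis
    by (simp add: power2_norm_eq_inner inner_diff_left inner_diff_right inner_commute)
qed

lemma shrink_blocks_firmly_nonexpansive:
  assumes "\<beta> > 0"
    and w: "\<forall>i. block w i = shrink \<beta> (Dpix i *v u)"
    and w': "\<forall>i. block w' i = shrink \<beta> (Dpix i *v u')"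
  shows "(norm (w - w'))\<^sup>2 \<le> (w - w') \<bullet> (Dfull *v (u - u'))"
proof -
  have "(norm (block (w - w') i))\<^sup>2 \<le> block (w - w') i \<bullet> block (Dfull *v (u - u')) i" for i
    using shrink_firmly_nonexpansive[OF assms(1), of "Dpix i *v u" "Dpix i *v u'"]
    by (simp add: block_diff block_Dfull matrix_vector_mult_diff_distrib
        w[THEN spec] w'[THEN spec])
  then show ?thesis
    unfolding norm_sq_eq_sum_block inner_eq_sum_block by (intro sum_mono) auto
qed

text \<open>
  The blocks matter only for the nonsmooth term; the coupling term is a single squared distance
  between stacked vectors.
\<close>

lemma ftvcs_objective_eq:
  "ftvcs_objective A f \<mu> \<beta> w u =
     (\<Sum>i\<in>UNIV. norm (block w i)) + \<beta> / 2 * (norm (w - Dfull *v u))\<^sup>2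
     + \<mu> / 2 * (norm (A *v u - f))\<^sup>2"
  by (simp add: ftvcs_objective_def sum.distrib norm_sq_eq_sum_block block_diff block_Dfull
      sum_distrib_left)

section \<open>The spectral radius bounds the operator norm\<close>

lemma transpose_inner: "(transpose M *v y) \<bullet> x = y \<bullet> (M *v x)" for M :: "real^'a^'b"
  by (simp add: dot_lmul_matrix)

lemma norm_sq_add_scaleR:
  fixes a b :: "'a::real_inner"
  shows "(norm (a + t *\<^sub>R b))\<^sup>2 = (norm a)\<^sup>2 + t * (2 * (a \<bullet> b)) + t\<^sup>2 * (norm b)\<^sup>2"
  by (simp add: power2_norm_eq_inner inner_add_left inner_add_right inner_commute)
    (simp add: power2_eq_square)

text \<open>
  The first-order condition at the minimum \<open>t = 0\<close> of a quadratic.  It replaces differentiation in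
  the Rayleigh quotient argument and in the optimality condition in \<open>u\<close>.
\<close>

lemma linear_coeff_zero_of_quadratic_nonneg:
  fixes L Q :: real
  assumes "\<And>t. 0 \<le> t * L + t\<^sup>2 * Q"
  shows "L = 0"
proof -
  define K where "K = \<bar>Q\<bar> + 1"
  have K: "K > 0" "Q \<le> K - 1" by (auto simp: K_def)
  \<comment> \<open>With \<open>K > Q\<close>, the step \<open>t = - L / K\<close> is short enough for the linear term to dominate.\<close>
  have "0 \<le> (- L / K) * L + (- L / K)\<^sup>2 * Q" by (rule assms)
  also have "\<dots> \<le> (- L / K) * L + (- L / K)\<^sup>2 * (K - 1)"
    using K by (intro add_left_mono mult_left_mono) auto
  also have "\<dots> = - (L / K)\<^sup>2" using K by (simp add: field_simps power2_eq_square)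
  finally show ?thesis using K by auto
qed

text \<open>
  The spectral radius is a supremum of reals, so it bounds the eigenvalues only once they are known
  to be bounded.
\<close>

lemma spectral_set_bdd_above:
  fixes M :: "real^'a^'a"
  shows "bdd_above {cmod z | z. \<exists>v. v \<noteq> 0 \<and> map_matrix complex_of_real M *v v = z *s v}"
proof -
  obtain K where K: "\<And>v. norm (map_matrix complex_of_real M *v v) \<le> norm v * K"
    using bounded_linear.bounded[OF matrix_vector_mul_bounded_linear] by blast
  have "cmod z \<le> K" if "v \<noteq> 0" "map_matrix complex_of_real M *v v = z *s v" for z and v
  proof -
    have "norm (z *s v) = cmod z * norm v"
      by (simp add: norm_vec_def norm_mult L2_set_right_distrib)
    then have "cmod z * norm v \<le> K * norm v" using K[of v] that by (simp add: mult.commute)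
    then show ?thesis using that by simp
  qed
  then show ?thesis by (auto intro!: bdd_aboveI)
qed

text \<open>
  Rayleigh's principle: where \<open>norm (A v)\<close> is maximal on the unit sphere, with value \<open>sqrt l\<close>, the
  nonnegative quadratic form \<open>l * norm x\<^sup>2 - norm (A x)\<^sup>2\<close> vanishes, so its gradient vanishes there
  too, which says that \<open>l\<close> is an eigenvalue of \<open>A\<^sup>T A\<close>.
\<close>

lemma norm_matrix_vector_sq_le_spectral_radius:
  fixes A :: "real^'a^'m"
  shows "(norm (A *v x))\<^sup>2 \<le> spectral_radius (transpose A ** A) * (norm x)\<^sup>2"
proof -
  have "\<exists>v\<in>sphere 0 1. \<forall>y\<in>sphere 0 1. norm (A *v y) \<le> norm (A *v v)"
  proof (rule continuous_attains_sup)
    show "sphere (0::real^'a) 1 \<noteq> {}" by simp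
    show "continuous_on (sphere 0 1) (\<lambda>x. norm (A *v x))"
      by (intro continuous_intros)
  qed simp
  then obtain v where v: "norm v = 1" and max: "\<And>y. norm y = 1 \<Longrightarrow> norm (A *v y) \<le> norm (A *v v)"
    by auto
  define l where "l = (norm (A *v v))\<^sup>2"
  have bound: "(norm (A *v y))\<^sup>2 \<le> l * (norm y)\<^sup>2" for y
  proof (cases "y = 0")
    case False
    have "norm (A *v y) = norm y * norm (A *v sgn y)"
      using False by (simp add: sgn_div_norm matrix_vector_mult_scaleR)
    also have "\<dots> \<le> norm y * norm (A *v v)"
      using False by (intro mult_left_mono max) (auto simp: norm_sgn)
    finally have "(norm (A *v y))\<^sup>2 \<le> (norm y * norm (A *v v))\<^sup>2" by (intro power_mono) auto
    then show ?thesis by (simp add: l_def power_mult_distrib mult.commute)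
  qed simp
  have "(transpose A *v (A *v v)) \<bullet> h = (l *\<^sub>R v) \<bullet> h" for h
  proof -
    have "2 * (l * (v \<bullet> h) - (A *v v) \<bullet> (A *v h)) = 0"
    proof (rule linear_coeff_zero_of_quadratic_nonneg)
      fix t :: real
      have "0 \<le> l * (norm (v + t *\<^sub>R h))\<^sup>2 - (norm (A *v (v + t *\<^sub>R h)))\<^sup>2"
        using bound[of "v + t *\<^sub>R h"] by simp
      also have "\<dots> = l * (norm v)\<^sup>2 - (norm (A *v v))\<^sup>2
          + (t * (2 * (l * (v \<bullet> h) - (A *v v) \<bullet> (A *v h)))
            + t\<^sup>2 * (l * (norm h)\<^sup>2 - (norm (A *v h))\<^sup>2))"
        unfolding matrix_vector_right_distrib matrix_vector_mult_scaleR norm_sq_add_scaleR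
        by (simp add: algebra_simps)
      finally show "0 \<le> t * (2 * (l * (v \<bullet> h) - (A *v v) \<bullet> (A *v h)))
            + t\<^sup>2 * (l * (norm h)\<^sup>2 - (norm (A *v h))\<^sup>2)"
        using v by (simp add: l_def)
    qed
    then show ?thesis unfolding transpose_inner by simp
  qed
  then have eig: "(transpose A ** A) *v v = l *\<^sub>R v"
    by (metis vector_eq_rdot matrix_vector_mul_assoc)
  \<comment> \<open>The spectral radius ranges over complex eigenvectors, so the real one is embedded.\<close>
  define cv :: "complex^'a" where "cv = (\<chi> i. complex_of_real (v $ i))"
  have "map_matrix complex_of_real (transpose A ** A) *v cv = complex_of_real l *s cv"
  proof -
    have "(map_matrix complex_of_real (transpose A ** A) *v cv) $ i
        = complex_of_real (((transpose A ** A) *v v) $ i)" for i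
      by (simp add: matrix_vector_mult_def cv_def)
    then show ?thesis by (simp add: vec_eq_iff eig cv_def)
  qed
  moreover have "v \<noteq> 0" using v by auto
  then have "cv \<noteq> 0" by (simp add: cv_def vec_eq_iff)
  ultimately have "cmod (complex_of_real l) \<le> spectral_radius (transpose A ** A)"
    unfolding spectral_radius_def by (intro cSup_upper spectral_set_bdd_above) blast
  moreover have "l \<ge> 0" by (simp add: l_def)
  ultimately have "l \<le> spectral_radius (transpose A ** A)" by simp
  then have "l * (norm x)\<^sup>2 \<le> spectral_radius (transpose A ** A) * (norm x)\<^sup>2"
    by (intro mult_right_mono) auto
  with bound[of x] show ?thesis by linarith
qed

section \<open>One step of the iteration\<close>

text \<open>
  The linear system in variational form, tested against every \<open>x\<close>; no transpose or matrix product
  remains.  The factor of the data term is \<open>\<mu> / (\<beta> * \<tau>) * \<tau> = \<mu> / \<beta>\<close>.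
\<close>

lemma ftvcs_step_weak:
  assumes "\<beta> > 0" "\<tau> > 0"
  shows "ftvcs_step A f \<mu> \<beta> \<tau> u w' u' \<longleftrightarrow>
     (\<forall>i. block w' i = shrink \<beta> (Dpix i *v u)) \<and>
     (\<forall>x. (Dfull *v u' - w') \<bullet> (Dfull *v x) + \<mu> / (\<beta> * \<tau>) * ((u' - u) \<bullet> x)
        + \<mu> / \<beta> * ((A *v u - f) \<bullet> (A *v x)) = 0)"
proof -
  define k where "k = \<mu> / (\<beta> * \<tau>)"
  have k: "\<mu> / \<beta> = k * \<tau>" using assms by (simp add: k_def)
  have "(transpose Dfull ** Dfull + k *\<^sub>R mat 1) *v u' =
       transpose Dfull *v w' + k *\<^sub>R (u - \<tau> *\<^sub>R (transpose A *v (A *v u - f))) \<longleftrightarrow>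
     (\<forall>x. (transpose Dfull *v (Dfull *v u') + k *\<^sub>R u') \<bullet> x =
       (transpose Dfull *v w' + k *\<^sub>R (u - \<tau> *\<^sub>R (transpose A *v (A *v u - f)))) \<bullet> x)"
    by (simp only: vector_eq_rdot matrix_vector_mult_add_rdistrib matrix_vector_mul_assoc
        scaleR_matrix_vector_assoc[symmetric] matrix_vector_mul_lid)
  also have "\<dots> \<longleftrightarrow> (\<forall>x. (Dfull *v u' - w') \<bullet> (Dfull *v x) + k * ((u' - u) \<bullet> x)
        + k * \<tau> * ((A *v u - f) \<bullet> (A *v x)) = 0)"
    by (simp only: inner_add_left inner_diff_left inner_scaleR_left transpose_inner)
      (simp add: algebra_simps)
  finally show ?thesis unfolding ftvcs_step_def k_def[symmetric] k by simp
qed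

text \<open>
  Controls the cross term \<open>A e \<bullet> A e'\<close> by the displacement \<open>A (e - e')\<close> alone.  The constant \<open>1/4\<close>
  is what makes step sizes up to \<open>2 / \<rho>\<close> admissible.
\<close>

lemma inner_ge_quarter: "x \<bullet> y \<ge> - ((norm (x - y))\<^sup>2 / 4)" for x y :: "'a::real_inner"
proof -
  have "0 \<le> (norm (x + y))\<^sup>2" by simp
  then show ?thesis
    by (simp add: power2_norm_eq_inner inner_add_left inner_add_right inner_diff_left
        inner_diff_right inner_commute field_simps)
qed

text \<open>
  The hypothesis puts \<open>d\<close> into the ball with diameter from \<open>0\<close> to \<open>a\<close>, that is
  \<open>norm (d - a/2) \<le> norm a / 2\<close>.
\<close>

lemma inner_le_of_firm:
  fixes a b d :: "'a::real_inner"
  assumes "(norm d)\<^sup>2 \<le> d \<bullet> a"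
  shows "b \<bullet> d \<le> ((norm a)\<^sup>2 + (norm b)\<^sup>2) / 2"
proof -
  have "0 \<le> (norm (d - (1/2) *\<^sub>R a - (1/2) *\<^sub>R b))\<^sup>2" "0 \<le> (norm (a - b))\<^sup>2" by simp_all
  with assms show ?thesis
    by (simp add: power2_norm_eq_inner inner_diff_left inner_diff_right inner_commute algebra_simps)
qed

text \<open>
  Subtract the variational equations of the two steps and test with the difference \<open>e'\<close> of the
  outputs.  Firm nonexpansiveness of shrinkage bounds the inner product of \<open>D e'\<close> with the
  difference of the shrunk vectors, and the spectral bound turns the data term into a part of the displacement that polarization of
  \<open>e' \<bullet> e\<close> supplies with the opposite sign.
\<close>

lemma ftvcs_step_averaged:
  fixes A :: "real ^ ('n::{finite,linorder} \<times> 'n) ^ 'm"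
  assumes pos: "\<mu> > 0" "\<beta> > 0" "\<tau> > 0"
    and s: "ftvcs_step A f \<mu> \<beta> \<tau> u w' u'" and t: "ftvcs_step A f \<mu> \<beta> \<tau> v z' v'"
  defines "\<kappa> \<equiv> \<mu> / (\<beta> * \<tau>)"
  shows "(norm (Dfull *v (u' - v')))\<^sup>2 + \<kappa> * (norm (u' - v'))\<^sup>2
       + \<kappa> * (1 - \<tau> * spectral_radius (transpose A ** A) / 2) * (norm ((u - v) - (u' - v')))\<^sup>2
     \<le> (norm (Dfull *v (u - v)))\<^sup>2 + \<kappa> * (norm (u - v))\<^sup>2"
proof -
  define \<rho> where "\<rho> = spectral_radius (transpose A ** A)"
  define e where "e = u - v"
  define e' where "e' = u' - v'"
  define d where "d = w' - z'"
  have \<kappa>: "\<kappa> > 0" "\<mu> / \<beta> = \<kappa> * \<tau>" using pos by (simp_all add: \<kappa>_def)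
  note S = s[unfolded ftvcs_step_weak[OF pos(2,3)] \<kappa>_def[symmetric] \<kappa>(2)]
  note T = t[unfolded ftvcs_step_weak[OF pos(2,3)] \<kappa>_def[symmetric] \<kappa>(2)]
  have "(Dfull *v u' - w') \<bullet> (Dfull *v e') + \<kappa> * ((u' - u) \<bullet> e')
        + \<kappa> * \<tau> * ((A *v u - f) \<bullet> (A *v e'))
      - ((Dfull *v v' - z') \<bullet> (Dfull *v e') + \<kappa> * ((v' - v) \<bullet> e')
        + \<kappa> * \<tau> * ((A *v v - f) \<bullet> (A *v e'))) = 0"
    using S T by simp
  then have eq: "(Dfull *v e') \<bullet> (Dfull *v e') + \<kappa> * (e' \<bullet> e')
      = (Dfull *v e') \<bullet> d + \<kappa> * (e' \<bullet> e) - \<kappa> * \<tau> * ((A *v e) \<bullet> (A *v e'))"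
    by (simp add: e_def e'_def d_def matrix_vector_mult_diff_distrib inner_diff_left
        inner_diff_right inner_commute algebra_simps)
  have "(norm d)\<^sup>2 \<le> d \<bullet> (Dfull *v e)"
    unfolding d_def e_def using shrink_blocks_firmly_nonexpansive[OF pos(2)] S T by blast
  from inner_le_of_firm[OF this, of "Dfull *v e'"]
  have D: "(Dfull *v e') \<bullet> d \<le> ((norm (Dfull *v e))\<^sup>2 + (norm (Dfull *v e'))\<^sup>2) / 2" .
  have "- ((A *v e) \<bullet> (A *v e')) \<le> (norm (A *v (e - e')))\<^sup>2 / 4"
    using inner_ge_quarter[of "A *v e" "A *v e'"] by (simp add: matrix_vector_mult_diff_distrib)
  also have "\<dots> \<le> \<rho> * (norm (e - e'))\<^sup>2 / 4"
    using norm_matrix_vector_sq_le_spectral_radius[of A "e - e'"] by (simp add: \<rho>_def)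
  finally have "\<kappa> * \<tau> * (- ((A *v e) \<bullet> (A *v e'))) \<le> \<kappa> * \<tau> * (\<rho> * (norm (e - e'))\<^sup>2 / 4)"
    using \<kappa> pos by (intro mult_left_mono) auto
  then have A: "- (\<kappa> * \<tau> * ((A *v e) \<bullet> (A *v e'))) \<le> \<kappa> * (\<tau> * \<rho> / 4) * (norm (e - e'))\<^sup>2"
    by (simp add: algebra_simps)
  have "\<kappa> * (e' \<bullet> e) = \<kappa> * (((norm e)\<^sup>2 + (norm e')\<^sup>2 - (norm (e - e'))\<^sup>2) / 2)"
    by (simp add: power2_norm_eq_inner inner_diff_left inner_diff_right inner_commute)
  moreover have "(norm (Dfull *v e'))\<^sup>2 + \<kappa> * (norm e')\<^sup>2
      = (Dfull *v e') \<bullet> (Dfull *v e') + \<kappa> * (e' \<bullet> e')"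
    by (simp add: power2_norm_eq_inner)
  ultimately have "(norm (Dfull *v e'))\<^sup>2 + \<kappa> * (norm e')\<^sup>2
      \<le> ((norm (Dfull *v e))\<^sup>2 + (norm (Dfull *v e'))\<^sup>2) / 2
        + \<kappa> * (((norm e)\<^sup>2 + (norm e')\<^sup>2 - (norm (e - e'))\<^sup>2) / 2)
        + \<kappa> * (\<tau> * \<rho> / 4) * (norm (e - e'))\<^sup>2"
    using eq D A by linarith
  then show ?thesis
    unfolding \<rho>_def[symmetric] e_def[symmetric] e'_def[symmetric] by (simp add: field_simps)
qed

section \<open>Fixed points and minimizers\<close>

text \<open>
  Sufficiency of first-order conditions for a convex objective: each of the three terms lies above
  its linearization at \<open>(w, u)\<close>, and at a fixed point the linear parts add up to zero.
\<close>

lemma ftvcs_fixed_point_is_minimizer: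
  assumes pos: "\<mu> > 0" "\<beta> > 0" "\<tau> > 0"
    and s: "ftvcs_step A f \<mu> \<beta> \<tau> u w u"
  shows "ftvcs_objective A f \<mu> \<beta> w u \<le> ftvcs_objective A f \<mu> \<beta> x v"
proof -
  note S = s[unfolded ftvcs_step_weak[OF pos(2,3)]]
  have "norm (block w i) + \<beta> * (block (Dfull *v u - w) i \<bullet> block (x - w) i) \<le> norm (block x i)" for i
    using shrink_subgradient[OF pos(2), of "Dpix i *v u" "block x i"]
    by (simp add: block_diff block_Dfull S[THEN conjunct1, THEN spec])
  then have "(\<Sum>i\<in>UNIV. norm (block w i) + \<beta> * (block (Dfull *v u - w) i \<bullet> block (x - w) i))
      \<le> (\<Sum>i\<in>UNIV. norm (block x i))"
    by (intro sum_mono)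
  then have 1: "(\<Sum>i\<in>UNIV. norm (block w i)) + \<beta> * ((Dfull *v u - w) \<bullet> (x - w))
      \<le> (\<Sum>i\<in>UNIV. norm (block x i))"
    by (simp add: sum.distrib inner_eq_sum_block sum_distrib_left)
  have convex: "c / 2 * (norm b)\<^sup>2 + c * (b \<bullet> (a - b)) \<le> c / 2 * (norm a)\<^sup>2"
    if "c > 0" for c and a b :: "'z::real_inner"
  proof -
    have "0 \<le> c / 2 * (norm (a - b))\<^sup>2" using that by simp
    then show ?thesis
      by (simp add: power2_norm_eq_inner inner_diff_left inner_diff_right inner_commute field_simps)
  qed
  have 2: "\<beta> / 2 * (norm (w - Dfull *v u))\<^sup>2
      + \<beta> * ((w - Dfull *v u) \<bullet> ((x - Dfull *v v) - (w - Dfull *v u)))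
      \<le> \<beta> / 2 * (norm (x - Dfull *v v))\<^sup>2"
    using convex[OF pos(2)] .
  have 3: "\<mu> / 2 * (norm (A *v u - f))\<^sup>2
      + \<mu> * ((A *v u - f) \<bullet> ((A *v v - f) - (A *v u - f)))
      \<le> \<mu> / 2 * (norm (A *v v - f))\<^sup>2"
    using convex[OF pos(1)] .
  have "(Dfull *v u - w) \<bullet> (Dfull *v (v - u)) + \<mu> / \<beta> * ((A *v u - f) \<bullet> (A *v (v - u))) = 0"
    using S by (metis add.right_neutral diff_self inner_zero_left mult_zero_right)
  then have "\<beta> * ((Dfull *v u - w) \<bullet> (Dfull *v (v - u))) + \<mu> * ((A *v u - f) \<bullet> (A *v (v - u))) = 0"
    using pos by (simp add: field_simps)
  then have "\<beta> * ((Dfull *v u - w) \<bullet> (x - w))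
      + \<beta> * ((w - Dfull *v u) \<bullet> ((x - Dfull *v v) - (w - Dfull *v u)))
      + \<mu> * ((A *v u - f) \<bullet> ((A *v v - f) - (A *v u - f))) = 0"
    by (simp add: matrix_vector_mult_diff_distrib inner_diff_left inner_diff_right algebra_simps)
  with 1 2 3 show ?thesis unfolding ftvcs_objective_eq by linarith
qed

text \<open>
  Optimality in \<open>w\<close> alone forces \<open>w\<close> to be the shrinkage \<open>s\<close> of \<open>D u\<close>, because the proximal objective
  exceeds its value at \<open>s\<close> by at least \<open>\<beta>/2 * norm (w - s)\<^sup>2\<close>.  Optimality in \<open>u\<close> alone is the linear
  equation, in which the proximal term vanishes as input and output agree.
\<close>

lemma ftvcs_minimizer_is_fixed_point:
  fixes A :: "real ^ ('n::{finite,linorder} \<times> 'n) ^ 'm"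
  assumes pos: "\<mu> > 0" "\<beta> > 0" "\<tau> > 0"
    and min: "\<And>x v. ftvcs_objective A f \<mu> \<beta> w u \<le> ftvcs_objective A f \<mu> \<beta> x v"
  shows "ftvcs_step A f \<mu> \<beta> \<tau> u w u"
proof -
  obtain s u' where s: "ftvcs_step A f \<mu> \<beta> \<tau> u s u'"
    using ftvcs_step_ex1[OF pos, of A f u] by blast
  then have sb: "block s i = shrink \<beta> (Dpix i *v u)" for i
    unfolding ftvcs_step_def by blast
  have "norm (block s i) + \<beta> * (block (Dfull *v u - s) i \<bullet> block (w - s) i) \<le> norm (block w i)" for i
    using shrink_subgradient[OF pos(2), of "Dpix i *v u" "block w i"]
    by (simp add: block_diff block_Dfull sb)
  then have "(\<Sum>i\<in>UNIV. norm (block s i) + \<beta> * (block (Dfull *v u - s) i \<bullet> block (w - s) i))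
      \<le> (\<Sum>i\<in>UNIV. norm (block w i))"
    by (intro sum_mono)
  then have "(\<Sum>i\<in>UNIV. norm (block s i)) + \<beta> * ((Dfull *v u - s) \<bullet> (w - s))
      \<le> (\<Sum>i\<in>UNIV. norm (block w i))"
    by (simp add: sum.distrib inner_eq_sum_block sum_distrib_left)
  moreover have "\<beta> / 2 * (norm (w - Dfull *v u))\<^sup>2 = \<beta> / 2 * (norm (s - Dfull *v u))\<^sup>2
      + \<beta> / 2 * (norm (w - s))\<^sup>2 - \<beta> * ((Dfull *v u - s) \<bullet> (w - s))"
    by (simp add: power2_norm_eq_inner inner_diff_left inner_diff_right inner_commute field_simps)
  ultimately have "\<beta> / 2 * (norm (w - s))\<^sup>2 \<le> 0"
    using min[of s u] unfolding ftvcs_objective_eq by linarith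
  then have ws: "w = s" using pos by (simp add: mult_le_0_iff)
  have "(Dfull *v u - w) \<bullet> (Dfull *v x) + \<mu> / \<beta> * ((A *v u - f) \<bullet> (A *v x)) = 0" for x
  proof -
    have "\<beta> * ((Dfull *v u - w) \<bullet> (Dfull *v x)) + \<mu> * ((A *v u - f) \<bullet> (A *v x)) = 0"
    proof (rule linear_coeff_zero_of_quadratic_nonneg)
      fix t :: real
      have D: "(norm (w - Dfull *v (u + t *\<^sub>R x)))\<^sup>2 = (norm (w - Dfull *v u))\<^sup>2
          + t * (2 * ((Dfull *v u - w) \<bullet> (Dfull *v x))) + t\<^sup>2 * (norm (Dfull *v x))\<^sup>2"
        using norm_sq_add_scaleR[of "w - Dfull *v u" t "- (Dfull *v x)"]
        by (simp add: matrix_vector_right_distrib matrix_vector_mult_scaleR inner_diff_left diff_diff_eq)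
      have A: "(norm (A *v (u + t *\<^sub>R x) - f))\<^sup>2 = (norm (A *v u - f))\<^sup>2
          + t * (2 * ((A *v u - f) \<bullet> (A *v x))) + t\<^sup>2 * (norm (A *v x))\<^sup>2"
        using norm_sq_add_scaleR[of "A *v u - f" t "A *v x"]
        by (simp add: matrix_vector_right_distrib matrix_vector_mult_scaleR algebra_simps)
      have "ftvcs_objective A f \<mu> \<beta> w (u + t *\<^sub>R x) - ftvcs_objective A f \<mu> \<beta> w u
          = t * (\<beta> * ((Dfull *v u - w) \<bullet> (Dfull *v x)) + \<mu> * ((A *v u - f) \<bullet> (A *v x)))
            + t\<^sup>2 * (\<beta> / 2 * (norm (Dfull *v x))\<^sup>2 + \<mu> / 2 * (norm (A *v x))\<^sup>2)"
        unfolding ftvcs_objective_eq D A by (simp add: field_simps)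
      with min[of w "u + t *\<^sub>R x"]
      show "0 \<le> t * (\<beta> * ((Dfull *v u - w) \<bullet> (Dfull *v x)) + \<mu> * ((A *v u - f) \<bullet> (A *v x)))
            + t\<^sup>2 * (\<beta> / 2 * (norm (Dfull *v x))\<^sup>2 + \<mu> / 2 * (norm (A *v x))\<^sup>2)"
        by linarith
    qed
    then show ?thesis using pos by (simp add: field_simps)
  qed
  then show ?thesis unfolding ftvcs_step_weak[OF pos(2,3)] using sb ws by simp
qed

text \<open>
  Coercivity: on a sublevel set the three terms bound \<open>w\<close>, then \<open>D u\<close>, and \<open>A u\<close>.  As \<open>A\<close> and \<open>D\<close> have
  no common nonzero null vector, \<open>u \<mapsto> (A u, D u)\<close> is injective and hence bounded below, so \<open>u\<close> is
  bounded as well.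
\<close>

lemma ftvcs_minimizer_exists:
  fixes A :: "real ^ ('n::{finite,linorder} \<times> 'n) ^ 'm"
  assumes pos: "\<mu> > 0" "\<beta> > 0"
    and null: "null_space A \<inter> null_space Dfull = {0}"
  shows "\<exists>w u. \<forall>x v. ftvcs_objective A f \<mu> \<beta> w u \<le> ftvcs_objective A f \<mu> \<beta> x v"
proof -
  define J where "J = (\<lambda>(w, u). ftvcs_objective A f \<mu> \<beta> w u)"
  define C where "C = J (0, 0)"
  define S where "S = {p. J p \<le> C}"
  have blk: "continuous_on UNIV
      (\<lambda>p :: (real ^ (('n \<times> 'n) + ('n \<times> 'n))) \<times> (real ^ ('n \<times> 'n)). block (fst p) i)" for i
    by (intro linear_continuous_on_compose[OF continuous_on_fst[OF continuous_on_id]]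
        linear_block)
  have cont: "continuous_on UNIV J"
    unfolding J_def ftvcs_objective_eq split_def
    by (intro continuous_intros blk linear_continuous_on_compose[OF _ matrix_vector_mul_linear])
  have "linear (\<lambda>u. (A *v u, Dfull *v u))"
    by (rule linearI) (simp_all add: matrix_vector_right_distrib matrix_vector_mult_scaleR)
  moreover have "inj (\<lambda>u. (A *v u, Dfull *v u))"
  proof (rule injI)
    fix x y assume "(A *v x, Dfull *v x) = (A *v y, Dfull *v y)"
    then have "x - y \<in> null_space A \<inter> null_space Dfull"
      by (simp add: null_space_def matrix_vector_mult_diff_distrib)
    with null show "x = y" by simp
  qed
  ultimately obtain B where B: "B > 0" "\<And>u. B * norm u \<le> norm (A *v u, Dfull *v u)"
    by (rule linear_inj_bounded_below_pos) blast
  \<comment> \<open>The bound \<open>C\<close> for \<open>w\<close>, followed by the resulting bound for \<open>u\<close>.\<close>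
  define R where "R = C + (C + (sqrt (2 * C / \<beta>) + (sqrt (2 * C / \<mu>) + norm f))) / B"
  have "norm (w, u) \<le> R" if "J (w, u) \<le> C" for w u
  proof -
    have J: "(\<Sum>i\<in>UNIV. norm (block w i)) + \<beta> / 2 * (norm (w - Dfull *v u))\<^sup>2
     + \<mu> / 2 * (norm (A *v u - f))\<^sup>2 \<le> C"
      using that by (simp add: J_def ftvcs_objective_eq)
    have nn: "0 \<le> (\<Sum>i\<in>UNIV. norm (block w i))" "0 \<le> \<beta> / 2 * (norm (w - Dfull *v u))\<^sup>2"
      "0 \<le> \<mu> / 2 * (norm (A *v u - f))\<^sup>2" using pos by (simp_all add: sum_nonneg)
    have w: "norm w \<le> C" using J nn norm_le_sum_norm_block[of w] by linarith
    have "\<beta> / 2 * (norm (w - Dfull *v u))\<^sup>2 \<le> C" using J nn by linarith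
    then have "(norm (w - Dfull *v u))\<^sup>2 \<le> 2 * C / \<beta>" using pos by (simp add: field_simps)
    then have 1: "norm (w - Dfull *v u) \<le> sqrt (2 * C / \<beta>)" by (rule real_le_rsqrt)
    have "\<mu> / 2 * (norm (A *v u - f))\<^sup>2 \<le> C" using J nn by linarith
    then have "(norm (A *v u - f))\<^sup>2 \<le> 2 * C / \<mu>" using pos by (simp add: field_simps)
    then have 2: "norm (A *v u - f) \<le> sqrt (2 * C / \<mu>)" by (rule real_le_rsqrt)
    have "norm (Dfull *v u) \<le> norm w + norm (w - Dfull *v u)"
      by (metis norm_minus_commute norm_triangle_sub)
    moreover have "norm (A *v u) \<le> norm f + norm (A *v u - f)" by (rule norm_triangle_sub)
    moreover have "B * norm u \<le> norm (A *v u) + norm (Dfull *v u)"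
      using B(2)[of u] norm_Pair_le[of "A *v u" "Dfull *v u"] by linarith
    ultimately have "B * norm u \<le> C + (sqrt (2 * C / \<beta>) + (sqrt (2 * C / \<mu>) + norm f))"
      using w 1 2 by linarith
    then have "norm u \<le> (C + (sqrt (2 * C / \<beta>) + (sqrt (2 * C / \<mu>) + norm f))) / B"
      using B(1) by (simp add: field_simps)
    with w norm_Pair_le[of w u] show ?thesis unfolding R_def by linarith
  qed
  then have "bounded S" by (auto simp: S_def bounded_iff)
  moreover have "closed S" unfolding S_def
    using cont by (intro closed_Collect_le) auto
  ultimately have "compact S" by (simp add: compact_eq_bounded_closed)
  moreover have "(0, 0) \<in> S" by (simp add: S_def C_def)
  ultimately obtain p where p: "p \<in> S" "\<And>q. q \<in> S \<Longrightarrow> J p \<le> J q"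
    using continuous_attains_inf[of S J] continuous_on_subset[OF cont] by blast
  have "J p \<le> J q" for q
    using p by (cases "q \<in> S") (auto simp: S_def)
  then show ?thesis unfolding J_def by (metis (mono_tags, lifting) case_prod_conv surj_pair)
qed

section \<open>Convergence\<close>

lemma tendsto_zero_of_norm_sq_le:
  assumes le: "\<And>k. (norm (g k))\<^sup>2 \<le> a k" and lim: "a \<longlonglongrightarrow> 0"
  shows "g \<longlonglongrightarrow> 0"
proof (rule Lim_null_comparison)
  show "\<forall>\<^sub>F k in sequentially. norm (g k) \<le> sqrt (a k)"
    using le by (intro always_eventually allI real_le_rsqrt)
  show "(\<lambda>k. sqrt (a k)) \<longlonglongrightarrow> 0" using tendsto_real_sqrt[OF lim] by simp
qed

text \<open>
  By the Cauchy-Schwarz inequality, firm nonexpansiveness makes shrinkage \<open>1\<close>-Lipschitz.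
\<close>

lemma tendsto_shrink_blocks:
  assumes "\<beta> > 0"
    and w: "\<And>k. \<forall>i. block (w k) i = shrink \<beta> (Dpix i *v u k)"
    and w': "\<forall>i. block w' i = shrink \<beta> (Dpix i *v u')"
    and u: "u \<longlonglongrightarrow> u'"
  shows "w \<longlonglongrightarrow> w'"
proof -
  have "norm (w k - w') \<le> norm (Dfull *v (u k - u'))" for k
  proof -
    have "norm (w k - w') * norm (w k - w') \<le> (w k - w') \<bullet> (Dfull *v (u k - u'))"
      using shrink_blocks_firmly_nonexpansive[OF assms(1) w w', of k] by (simp add: power2_eq_square)
    also have "\<dots> \<le> norm (w k - w') * norm (Dfull *v (u k - u'))" by (rule norm_cauchy_schwarz)
    finally show ?thesis by (cases "w k = w'") auto
  qed
  moreover have "(\<lambda>k. norm (Dfull *v (u k - u'))) \<longlonglongrightarrow> norm (Dfull *v (u' - u'))"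
    by (intro tendsto_norm bounded_linear.tendsto[OF matrix_vector_mul_bounded_linear]
        tendsto_diff u tendsto_const)
  ultimately have "(\<lambda>k. w k - w') \<longlonglongrightarrow> 0"
    by (intro Lim_null_comparison[of "\<lambda>k. w k - w'" "\<lambda>k. norm (Dfull *v (u k - u'))"]) auto
  then show ?thesis by (simp add: LIM_zero_iff)
qed

theorem theorem2p1:
  fixes A :: "real ^ ('n::{finite,linorder} \<times> 'n) ^ 'm"
    and f :: "real ^ 'm"
    and \<mu> \<beta> \<tau> :: real
    and w :: "nat \<Rightarrow> real ^ (('n \<times> 'n) + ('n \<times> 'n))"
    and u :: "nat \<Rightarrow> real ^ ('n \<times> 'n)"
  assumes "\<mu> > 0"
    and "null_space A \<inter> null_space Dfull = {0}"
    and "\<beta> > 0"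
    and "0 < \<tau>"
    and "\<tau> < 2 / spectral_radius (transpose A ** A)"
    and "\<And>k. ftvcs_step A f \<mu> \<beta> \<tau> (u k) (w (Suc k)) (u (Suc k))"
  shows "\<exists>ws us. (\<lambda>k. (w k, u k)) \<longlonglongrightarrow> (ws, us) \<and>
           is_arg_min (\<lambda>(w', u'). ftvcs_objective A f \<mu> \<beta> w' u') (\<lambda>_. True) (ws, us)"
proof -
  note pos = assms(1,3,4) and step = assms(6)
  define \<kappa> where "\<kappa> = \<mu> / (\<beta> * \<tau>)"
  define V where "V = (\<lambda>e :: real ^ ('n \<times> 'n). (norm (Dfull *v e))\<^sup>2 + \<kappa> * (norm e)\<^sup>2)"
  define c where "c = \<kappa> * (1 - \<tau> * spectral_radius (transpose A ** A) / 2)"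
  have \<kappa>: "\<kappa> > 0" using pos by (simp add: \<kappa>_def)
  have "0 < 2 / spectral_radius (transpose A ** A)" using assms(4,5) by linarith
  \<comment> \<open>A zero spectral radius would make the bound on \<open>\<tau>\<close> read \<open>\<tau> < 2 / 0 = 0\<close>.\<close>
  then have "spectral_radius (transpose A ** A) > 0" by (simp add: zero_less_divide_iff)
  then have c: "c > 0" using assms(5) \<kappa> by (simp add: c_def field_simps)
  have V_ge: "\<kappa> * (norm e)\<^sup>2 \<le> V e" for e by (simp add: V_def)
  then have V_nonneg: "0 \<le> V e" for e using \<kappa> by (meson order_trans mult_nonneg_nonneg less_imp_le zero_le_power2)
  have Fejer: "V (u (Suc k) - v) + c * (norm (u k - u (Suc k)))\<^sup>2 \<le> V (u k - v)"
    if "ftvcs_step A f \<mu> \<beta> \<tau> v z v" for v z k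
    using ftvcs_step_averaged[OF pos step that, of k] by (simp add: V_def \<kappa>_def c_def)
  obtain w0 u0 where "\<And>x v. ftvcs_objective A f \<mu> \<beta> w0 u0 \<le> ftvcs_objective A f \<mu> \<beta> x v"
    using ftvcs_minimizer_exists[OF assms(1,3,2)] by metis
  then have fix0: "ftvcs_step A f \<mu> \<beta> \<tau> u0 w0 u0" by (rule ftvcs_minimizer_is_fixed_point[OF pos])
  have dec: "decseq (\<lambda>k. V (u k - v))" if "ftvcs_step A f \<mu> \<beta> \<tau> v z v" for v z
  proof (rule decseq_SucI)
    fix k
    have "0 \<le> c * (norm (u k - u (Suc k)))\<^sup>2" using c by simp
    then show "V (u (Suc k) - v) \<le> V (u k - v)" using Fejer[OF that, of k] by linarith
  qed

  \<comment> \<open>The energy distances to a fixed point converge, so their decrements, which dominate the squared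
    displacements, vanish in the limit.\<close>
  have diff: "(\<lambda>k. u k - u (Suc k)) \<longlonglongrightarrow> 0"
  proof -
    obtain L where L: "(\<lambda>k. V (u k - u0)) \<longlonglongrightarrow> L"
      using decseq_convergent[OF dec[OF fix0]] V_nonneg by metis
    have "(\<lambda>k. (V (u k - u0) - V (u (Suc k) - u0)) / c) \<longlonglongrightarrow> (L - L) / c"
      using c by (intro tendsto_intros L LIMSEQ_Suc[OF L]) auto
    then have lim: "(\<lambda>k. (V (u k - u0) - V (u (Suc k) - u0)) / c) \<longlonglongrightarrow> 0" by simp
    have "(norm (u k - u (Suc k)))\<^sup>2 \<le> (V (u k - u0) - V (u (Suc k) - u0)) / c" for k
      using Fejer[OF fix0, of k] c by (simp add: pos_le_divide_eq mult.commute)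
    from tendsto_zero_of_norm_sq_le[OF this lim] show ?thesis .
  qed

  have "bounded (range u)"
  proof -
    have "norm (u k - u0) \<le> sqrt (V (u 0 - u0) / \<kappa>)" for k
    proof (rule real_le_rsqrt)
      have "\<kappa> * (norm (u k - u0))\<^sup>2 \<le> V (u 0 - u0)"
        using V_ge[of "u k - u0"] decseqD[OF dec[OF fix0], of 0 k] by linarith
      then show "(norm (u k - u0))\<^sup>2 \<le> V (u 0 - u0) / \<kappa>" using \<kappa> by (simp add: field_simps)
    qed
    then have "range u \<subseteq> cball u0 (sqrt (V (u 0 - u0) / \<kappa>))"
      by (auto simp: dist_norm norm_minus_commute)
    then show ?thesis by (rule bounded_subset[OF bounded_cball])
  qed
  then obtain us r where r: "strict_mono r" and ur: "(u \<circ> r) \<longlonglongrightarrow> us"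
    using bounded_imp_convergent_subsequence by blast
  obtain ws u1 where ws: "ftvcs_step A f \<mu> \<beta> \<tau> us ws u1"
    using ftvcs_step_ex1[OF pos, of A f us] by blast
  have wb: "\<forall>i. block ws i = shrink \<beta> (Dpix i *v us)" 
    using ws unfolding ftvcs_step_def by blast
  have step_blocks: "\<forall>i. block (w (Suc k)) i = shrink \<beta> (Dpix i *v u k)" for k
    using step[of k] unfolding ftvcs_step_def by blast

  \<comment> \<open>Both \<open>u (r k)\<close> and \<open>u (Suc (r k))\<close> tend to \<open>us\<close>, so the variational equation passes to the
    limit with input and output equal.\<close>
  have fix1: "ftvcs_step A f \<mu> \<beta> \<tau> us ws us"
    unfolding ftvcs_step_weak[OF pos(2,3)]
  proof (intro conjI allI wb[rule_format])
    fix x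
    have wr: "(\<lambda>k. w (Suc (r k))) \<longlonglongrightarrow> ws"
      by (rule tendsto_shrink_blocks[OF pos(2) step_blocks wb]) (use ur in \<open>simp add: o_def\<close>)
    have "(\<lambda>k. u (r k) - (u (r k) - u (Suc (r k)))) \<longlonglongrightarrow> us - 0"
      using ur LIMSEQ_subseq_LIMSEQ[OF diff r] by (intro tendsto_diff) (simp_all add: o_def)
    then have ur': "(\<lambda>k. u (Suc (r k))) \<longlonglongrightarrow> us" by simp
    have "(\<lambda>k. (Dfull *v u (Suc (r k)) - w (Suc (r k))) \<bullet> (Dfull *v x)
        + \<mu> / (\<beta> * \<tau>) * ((u (Suc (r k)) - u (r k)) \<bullet> x)
        + \<mu> / \<beta> * ((A *v u (r k) - f) \<bullet> (A *v x)))
      \<longlonglongrightarrow> (Dfull *v us - ws) \<bullet> (Dfull *v x) + \<mu> / (\<beta> * \<tau>) * ((us - us) \<bullet> x)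
        + \<mu> / \<beta> * ((A *v us - f) \<bullet> (A *v x))"
      using ur unfolding o_def
      by (intro tendsto_intros ur' wr bounded_linear.tendsto[OF matrix_vector_mul_bounded_linear])
    moreover have "(Dfull *v u (Suc (r k)) - w (Suc (r k))) \<bullet> (Dfull *v x)
        + \<mu> / (\<beta> * \<tau>) * ((u (Suc (r k)) - u (r k)) \<bullet> x)
        + \<mu> / \<beta> * ((A *v u (r k) - f) \<bullet> (A *v x)) = 0" for k
      using step[of "r k"] unfolding ftvcs_step_weak[OF pos(2,3)] by blast
    ultimately show "(Dfull *v us - ws) \<bullet> (Dfull *v x) + \<mu> / (\<beta> * \<tau>) * ((us - us) \<bullet> x)
        + \<mu> / \<beta> * ((A *v us - f) \<bullet> (A *v x)) = 0"
      by (simp add: LIMSEQ_const_iff)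
  qed

  have u_lim: "u \<longlonglongrightarrow> us"
  proof -
    obtain L where L: "(\<lambda>k. V (u k - us)) \<longlonglongrightarrow> L"
      using decseq_convergent[OF dec[OF fix1]] V_nonneg by metis
    have "(\<lambda>k. V (u (r k) - us)) \<longlonglongrightarrow> V (us - us)"
      using ur unfolding V_def o_def
      by (intro tendsto_intros bounded_linear.tendsto[OF matrix_vector_mul_bounded_linear])
    then have "L = 0"
      using LIMSEQ_unique LIMSEQ_subseq_LIMSEQ[OF L r] by (fastforce simp: V_def o_def)
    with L have "(\<lambda>k. V (u k - us) / \<kappa>) \<longlonglongrightarrow> 0 / \<kappa>"
      using \<kappa> by (intro tendsto_divide tendsto_const) auto
    then have lim: "(\<lambda>k. V (u k - us) / \<kappa>) \<longlonglongrightarrow> 0" by simp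
    have "(norm (u k - us))\<^sup>2 \<le> V (u k - us) / \<kappa>" for k
      using V_ge[of "u k - us"] \<kappa> by (simp add: pos_le_divide_eq mult.commute)
    from tendsto_zero_of_norm_sq_le[OF this lim] show ?thesis by (rule LIM_zero_cancel)
  qed
  have "(\<lambda>k. w (Suc k)) \<longlonglongrightarrow> ws"
    by (rule tendsto_shrink_blocks[OF pos(2) step_blocks wb u_lim])
  then have "(\<lambda>k. (w k, u k)) \<longlonglongrightarrow> (ws, us)"
    by (intro tendsto_Pair u_lim) (simp add: filterlim_sequentially_Suc)
  moreover have "is_arg_min (\<lambda>(w', u'). ftvcs_objective A f \<mu> \<beta> w' u') (\<lambda>_. True) (ws, us)"
    using ftvcs_fixed_point_is_minimizer[OF pos fix1] by (force simp: is_arg_min_def not_less)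
  ultimately show ?thesis by blast
qed

end
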